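(* The following hold. 1. Every $(s,a)$-rectangular uncertainty set is also $r$-rectangular. 2. There exists an $r$-rectangular uncertainty set that is not $s$-rectangular. 3. There exists an $r$-rectangular uncertainty set that is not $(s,a)$-rectangular. 4. There exists an $s$-rectangular uncertainty set that is not $r$-rectangular.
   Context: Let $\mathcal{S}$ be a finite set of states with $|\mathcal{S}|=S$ and $\mathcal{A}$ a finite set of actions with $|\mathcal{A}|=A$ (in the existence statements, these sets may be chosen). A transition kernel is $P=(P_{sas'})\in\mathbb{R}_+^{S\times A\times S}$ with $\sum_{s'}P_{sas'}=1$ for all $(s,a)$; write $P_{sa}=(P_{sas'})_{s'}\in\mathbb{R}^S_+$ and $P_s=(P_{sas'})_{a,s'}$. An uncertainty set is a compact convex set of transition kernels. An uncertainty set is $(s,a)$-rectangular if it is a Cartesian product $\times_{(s,a)}\mathbb{P}_{sa}$ with $\mathbb{P}_{sa}\subseteq\mathbb{R}^S_+$, and $s$-rectangular if it is a Cartesian product $\times_{s}\mathbb{P}_s$ with $\mathbb{P}_s\subseteq\mathbb{R}_+^{A\times S}$. A factor matrix uncertainty set is a set of the form $$\mathbb{P}=\Big\{\Big(\sum_{i=1}^r u^i_{sa}w_{i,s'}\Big)_{sas'}\ \Big|\ W=(w_1,\dots,w_r)\in\mathcal{W}\Big\},$$ where $r\ge1$ is an integer, $u^i_{sa}\ge 0$ are fixed with $\sum_{i=1}^r u^i_{sa}=1$ for all $(s,a)$, and $\mathcal{W}\subseteq\mathbb{R}_+^{S\times r}$ is a convex compact set such that every $W\in\mathcal{W}$ satisfies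 $\sum_{s'}w_{i,s'}=1$ for all $i$. An uncertainty set is $r$-rectangular if it can be written as a factor matrix uncertainty set, for some integer $r\ge 1$ and some coefficients $u^i_{sa}$, with $\mathcal{W}=\mathcal{W}^1\times\dots\times\mathcal{W}^r$ for some $\mathcal{W}^1,\dots,\mathcal{W}^r\subset\mathbb{R}_+^S$ (that is, the factors $w_i\in\mathcal{W}^i$ can be chosen independently of each other). *)

theory Defs
  imports "HOL-Analysis.Analysis" "HOL-Library.Function_Algebras"
begin

text \<open>
  The pointwise vector space structure on functions makes the library notion \<^const>\<open>convex\<close>
  available for sets of kernels; \<^const>\<open>compact\<close> refers to the product topology on functions.
\<close>

instantiation "fun" :: (type, real_vector) real_vector
begin

definition scaleR_fun :: "real \<Rightarrow> ('a \<Rightarrow> 'b) \<Rightarrow> 'a \<Rightarrow> 'b"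
  where "scaleR_fun c f = (\<lambda>x. c *\<^sub>R f x)"

instance
  by standard (auto simp: scaleR_fun_def fun_eq_iff algebra_simps)

end

text \<open>
  Since the number of states and actions is existentially quantified in some claims, states and
  actions are elements of finite carrier sets.  The space of nonnegative vectors indexed by a
  finite set \<open>I\<close> is the extensional function space \<open>I \<rightarrow>\<^sub>E {0..}\<close>.  Outside the
  carrier all its elements have the same value \<^const>\<open>undefined\<close>; affine combinations preserve
  this value, so convexity and compactness are those of the finite-dimensional space.
\<close>

type_synonym ('s, 'a) kernel = "'s \<Rightarrow> 'a \<Rightarrow> 's \<Rightarrow> real"

definition finite_spaces :: "'s set \<Rightarrow> 'a set \<Rightarrow> bool" where
  "finite_spaces S A \<longleftrightarrow> finite S \<and> S \<noteq> {} \<and> finite A \<and> A \<noteq> {}"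

definition transition_kernels :: "'s set \<Rightarrow> 'a set \<Rightarrow> ('s, 'a) kernel set" where
  "transition_kernels S A =
     {P \<in> S \<rightarrow>\<^sub>E A \<rightarrow>\<^sub>E S \<rightarrow>\<^sub>E {0..}. \<forall>s\<in>S. \<forall>a\<in>A. (\<Sum>s'\<in>S. P s a s') = 1}"

definition uncertainty_set :: "'s set \<Rightarrow> 'a set \<Rightarrow> ('s, 'a) kernel set \<Rightarrow> bool" where
  "uncertainty_set S A \<P> \<longleftrightarrow> \<P> \<subseteq> transition_kernels S A \<and> compact \<P> \<and> convex \<P>"

definition sa_rectangular :: "'s set \<Rightarrow> 'a set \<Rightarrow> ('s, 'a) kernel set \<Rightarrow> bool" where
  "sa_rectangular S A \<P> \<longleftrightarrow>
     (\<exists>Psa :: 's \<Rightarrow> 'a \<Rightarrow> ('s \<Rightarrow> real) set.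
        (\<forall>s\<in>S. \<forall>a\<in>A. Psa s a \<subseteq> S \<rightarrow>\<^sub>E {0..}) \<and>
        \<P> = (\<Pi>\<^sub>E s\<in>S. \<Pi>\<^sub>E a\<in>A. Psa s a))"

definition s_rectangular :: "'s set \<Rightarrow> 'a set \<Rightarrow> ('s, 'a) kernel set \<Rightarrow> bool" where
  "s_rectangular S A \<P> \<longleftrightarrow>
     (\<exists>Ps :: 's \<Rightarrow> ('a \<Rightarrow> 's \<Rightarrow> real) set.
        (\<forall>s\<in>S. Ps s \<subseteq> A \<rightarrow>\<^sub>E S \<rightarrow>\<^sub>E {0..}) \<and>
        \<P> = (\<Pi>\<^sub>E s\<in>S. Ps s))"

definition factor_coefficients ::
  "'s set \<Rightarrow> 'a set \<Rightarrow> nat \<Rightarrow> (nat \<Rightarrow> 's \<Rightarrow> 'a \<Rightarrow> real) \<Rightarrow> bool" where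
  "factor_coefficients S A r u \<longleftrightarrow>
     (\<forall>s\<in>S. \<forall>a\<in>A. (\<forall>i\<in>{1..r}. 0 \<le> u i s a) \<and> (\<Sum>i=1..r. u i s a) = 1)"

text \<open>A factor matrix \<open>W\<close> is given by its columns \<open>W 1, \<dots>, W r\<close>.\<close>

definition factor_matrices :: "'s set \<Rightarrow> nat \<Rightarrow> (nat \<Rightarrow> 's \<Rightarrow> real) set \<Rightarrow> bool" where
  "factor_matrices S r \<W> \<longleftrightarrow>
     \<W> \<subseteq> ({1..r} \<rightarrow>\<^sub>E S \<rightarrow>\<^sub>E {0..}) \<and> compact \<W> \<and> convex \<W> \<and>
     (\<forall>W\<in>\<W>. \<forall>i\<in>{1..r}. (\<Sum>s'\<in>S. W i s') = 1)"

definition factor_kernel ::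
  "'s set \<Rightarrow> 'a set \<Rightarrow> nat \<Rightarrow> (nat \<Rightarrow> 's \<Rightarrow> 'a \<Rightarrow> real) \<Rightarrow> (nat \<Rightarrow> 's \<Rightarrow> real) \<Rightarrow> ('s, 'a) kernel" where
  "factor_kernel S A r u W =
     (\<lambda>s\<in>S. \<lambda>a\<in>A. \<lambda>s'\<in>S. \<Sum>i=1..r. u i s a * W i s')"

definition factor_matrix_representation ::
  "'s set \<Rightarrow> 'a set \<Rightarrow> nat \<Rightarrow> (nat \<Rightarrow> 's \<Rightarrow> 'a \<Rightarrow> real) \<Rightarrow> (nat \<Rightarrow> 's \<Rightarrow> real) set \<Rightarrow>
   ('s, 'a) kernel set \<Rightarrow> bool" where
  "factor_matrix_representation S A r u \<W> \<P> \<longleftrightarrow>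
     1 \<le> r \<and> factor_coefficients S A r u \<and> factor_matrices S r \<W> \<and>
     \<P> = factor_kernel S A r u ` \<W>"

definition r_rectangular :: "'s set \<Rightarrow> 'a set \<Rightarrow> ('s, 'a) kernel set \<Rightarrow> bool" where
  "r_rectangular S A \<P> \<longleftrightarrow>
     (\<exists>r u \<W> Wi.
        factor_matrix_representation S A r u \<W> \<P> \<and>
        (\<forall>i\<in>{1..r}. Wi i \<subseteq> S \<rightarrow>\<^sub>E {0..}) \<and>
        \<W> = (\<Pi>\<^sub>E i\<in>{1..r}. Wi i))"

end

theory Submission
  imports Defs
begin

text \<open>
  For the first claim take one factor per state-action pair, with \<open>u\<close> the indicator of that pair.

  For the second and third, a single factor ranging over a segment forces all rows of the kernel to
  be equal, whereas an \<open>s\<close>-rectangular set allows the rows to be chosen independently.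

  For the fourth, couple two actions in one state by \<open>P 0 0 0 + P 0 1 0 = 1\<close> with \<open>P 0 0 0\<close>
  arbitrary in \<open>[0, 1]\<close>.  In an \<open>r\<close>-rectangular set each factor may be chosen to have the larger of
  two given entries \<open>w\<^sub>i\<^sub>,\<^sub>0\<close>; as the coefficients are nonnegative, this yields a kernel dominating the
  kernels with \<open>P 0 0 0 = 1\<close> and \<open>P 0 1 0 = 1\<close> simultaneously, so that the two entries sum
  to at least \<open>2\<close>.
\<close>

section \<open>Affine and continuous maps between spaces of restricted functions\<close>

text \<open>Compatibility is demanded for convex combinations only, because maps built with
  \<open>restrict\<close> are affine but not linear.\<close>

lemma convex_affine_image:
  assumes "convex X"
    and "\<And>x y u v. \<lbrakk>x \<in> X; y \<in> X; 0 \<le> u; 0 \<le> v; u + v = 1\<rbrakk> \<Longrightarrow>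
           f (u *\<^sub>R x + v *\<^sub>R y) = u *\<^sub>R f x + v *\<^sub>R f y"
  shows "convex (f ` X)"
proof (rule convexI)
  fix p q :: 'b and u v :: real
  assume "p \<in> f ` X" "q \<in> f ` X" and uv: "0 \<le> u" "0 \<le> v" "u + v = 1"
  then obtain x y where xy: "x \<in> X" "y \<in> X" and "p = f x" "q = f y" by blast
  then have "u *\<^sub>R p + v *\<^sub>R q = f (u *\<^sub>R x + v *\<^sub>R y)" using assms(2) uv by simp
  moreover have "u *\<^sub>R x + v *\<^sub>R y \<in> X" using assms(1) xy uv by (simp add: convexD)
  ultimately show "u *\<^sub>R p + v *\<^sub>R q \<in> f ` X" by blast
qed

lemma scaleR_fun_apply:
  "(c *\<^sub>R f) x = c *\<^sub>R f x"
  by (simp add: scaleR_fun_def)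

text \<open>Outside \<open>I\<close> both sides must equal \<open>undefined\<close>, and a
  combination of \<open>undefined\<close> with itself returns it because the weights sum to
  1.\<close>

lemma restrict_affine:
  fixes f g :: "'i \<Rightarrow> 'b::real_vector"
  assumes "u + v = 1"
  shows "u *\<^sub>R restrict f I + v *\<^sub>R restrict g I = (\<lambda>i\<in>I. u *\<^sub>R f i + v *\<^sub>R g i)"
  using assms by (auto simp: fun_eq_iff scaleR_fun_apply simp flip: scaleR_left_distrib)

lemma continuous_on_restrict:
  assumes "\<And>i. i \<in> I \<Longrightarrow> continuous_on X (\<lambda>x. f x i)"
  shows "continuous_on X (\<lambda>x. restrict (f x) I)"
proof (rule continuous_on_coordinatewise_then_product)
  fix i
  show "continuous_on X (\<lambda>x. restrict (f x) I i)"
    by (cases "i \<in> I") (simp_all add: assms)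
qed

lemma continuous_on_coordinate_pair: "continuous_on X (\<lambda>x. x i j)"
  by (rule continuous_on_product_then_coordinatewise[where f = "\<lambda>x. x i"],
      rule continuous_on_subset[OF continuous_on_product_coordinates subset_UNIV])

section \<open>Kernels generated by factor matrices\<close>

lemma factor_kernel_affine:
  assumes "a + b = 1"
  shows "factor_kernel S A r u (a *\<^sub>R V + b *\<^sub>R W) =
         a *\<^sub>R factor_kernel S A r u V + b *\<^sub>R factor_kernel S A r u W"
  unfolding factor_kernel_def restrict_affine[OF assms]
  by (simp add: scaleR_fun_def algebra_simps sum.distrib sum_distrib_left)

lemma continuous_on_factor_kernel: "continuous_on X (factor_kernel S A r u)"
  unfolding factor_kernel_def
  by (intro continuous_on_restrict continuous_on_sum continuous_on_mult_left
      continuous_on_coordinate_pair)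

text \<open>Each row is a convex combination, with weights \<open>u i s a\<close>, of the
  probability vectors \<open>W i\<close>.\<close>

lemma factor_kernel_in_transition_kernels:
  assumes "factor_coefficients S A r u" "factor_matrices S r \<W>" "W \<in> \<W>"
  shows "factor_kernel S A r u W \<in> transition_kernels S A"
proof -
  have W: "W i s \<ge> 0" if "i \<in> {1..r}" "s \<in> S" for i s
    using assms(2,3) that unfolding factor_matrices_def by (fastforce simp: PiE_iff)
  have "(\<Sum>s'\<in>S. \<Sum>i=1..r. u i s a * W i s') = 1" if "s \<in> S" "a \<in> A" for s a
  proof -
    have "(\<Sum>s'\<in>S. \<Sum>i=1..r. u i s a * W i s') = (\<Sum>i=1..r. u i s a * (\<Sum>s'\<in>S. W i s'))"
      by (subst sum.swap) (simp add: sum_distrib_left)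
    also have "\<dots> = (\<Sum>i=1..r. u i s a)"
      using assms(2,3) unfolding factor_matrices_def by (intro sum.cong) auto
    finally show ?thesis using assms(1) that unfolding factor_coefficients_def by simp
  qed
  moreover have "(\<Sum>i=1..r. u i s a * W i s') \<ge> 0" if "s \<in> S" "a \<in> A" "s' \<in> S" for s a s'
    using assms(1) that W unfolding factor_coefficients_def
    by (intro sum_nonneg mult_nonneg_nonneg) auto
  ultimately show ?thesis
    by (auto simp: transition_kernels_def factor_kernel_def)
qed

text \<open>The kernel depends affinely and continuously on \<open>W\<close>, so convexity and
  compactness pass from \<open>\<W>\<close> to its image.\<close>

lemma uncertainty_set_factor_matrix:
  assumes "factor_matrix_representation S A r u \<W> \<P>"
  shows "uncertainty_set S A \<P>"
proof -
  from assms have u: "factor_coefficients S A r u" and \<W>: "factor_matrices S r \<W>"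
    and \<P>: "\<P> = factor_kernel S A r u ` \<W>"
    unfolding factor_matrix_representation_def by auto
  have "compact \<W>" "convex \<W>" using \<W> unfolding factor_matrices_def by auto
  then show ?thesis
    unfolding uncertainty_set_def \<P> using factor_kernel_in_transition_kernels[OF u \<W>]
    by (auto intro!: compact_continuous_image continuous_on_factor_kernel convex_affine_image
        simp: factor_kernel_affine)
qed

section \<open>State-action rectangular sets\<close>

text \<open>By contraposition, an example for the second claim also serves the third.\<close>

lemma sa_rectangular_imp_s_rectangular:
  assumes "sa_rectangular S A \<P>"
  shows "s_rectangular S A \<P>"
proof -
  from assms obtain Psa where "\<forall>s\<in>S. \<forall>a\<in>A. Psa s a \<subseteq> S \<rightarrow>\<^sub>E {0..}"
    and "\<P> = (\<Pi>\<^sub>E s\<in>S. \<Pi>\<^sub>E a\<in>A. Psa s a)"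
    unfolding sa_rectangular_def by blast
  then show ?thesis
    unfolding s_rectangular_def
    by (intro exI[of _ "\<lambda>s. \<Pi>\<^sub>E a\<in>A. Psa s a"] conjI ballI PiE_mono) simp
qed

lemma sa_rectangular_imp_r_rectangular:
  assumes "finite_spaces S A" "uncertainty_set S A \<P>" "sa_rectangular S A \<P>"
  shows "r_rectangular S A \<P>"
proof -
  from assms(3) obtain Psa where sub: "\<forall>s\<in>S. \<forall>a\<in>A. Psa s a \<subseteq> S \<rightarrow>\<^sub>E {0..}"
    and \<P>: "\<P> = (\<Pi>\<^sub>E s\<in>S. \<Pi>\<^sub>E a\<in>A. Psa s a)"
    unfolding sa_rectangular_def by blast
  define r where "r = card (S \<times> A)"
  have fin: "finite (S \<times> A)" and ne: "S \<times> A \<noteq> {}"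
    using assms(1) unfolding finite_spaces_def by auto
  then have r: "1 \<le> r" by (simp add: r_def Suc_le_eq card_gt_0_iff)
  \<comment> \<open>\<open>h\<close> numbers the state-action pairs by \<open>1..r\<close>; its
    inverse \<open>g\<close> tells which pair a factor belongs to.\<close>
  obtain h where h: "bij_betw h (S \<times> A) {1..r}"
    using fin by (metis r_def bij_betw_iff_card card_atLeastAtMost diff_Suc_1 finite_atLeastAtMost)
  define g where "g = inv_into (S \<times> A) h"
  have g_mem: "g i \<in> S \<times> A" and h_g: "h (g i) = i" if "i \<in> {1..r}" for i
    using h that unfolding g_def
    by (metis bij_betw_imp_surj_on inv_into_into, metis bij_betw_inv_into_right)
  have h_mem: "h x \<in> {1..r}" and g_h: "g (h x) = x" if "x \<in> S \<times> A" for x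
    using h that unfolding g_def by (metis bij_betwE, metis bij_betw_inv_into_left)
  have g_in: "fst (g i) \<in> S" "snd (g i) \<in> A" if "i \<in> {1..r}" for i
    using g_mem[OF that] by auto
  define u :: "nat \<Rightarrow> 'a \<Rightarrow> 'b \<Rightarrow> real" where "u = (\<lambda>i s a. if i = h (s, a) then 1 else 0)"
  define \<Phi> where "\<Phi> = (\<lambda>P :: ('a, 'b) kernel. \<lambda>i\<in>{1..r}. P (fst (g i)) (snd (g i)))"
  define Wi where "Wi = (\<lambda>i. Psa (fst (g i)) (snd (g i)))"
  \<comment> \<open>\<open>\<Phi>\<close> lists the rows of a kernel as factors. Compactness,
    convexity and row sums are then carried over from \<open>\<P>\<close>. They cannot be taken from
    the sets \<open>Psa s a\<close> one by one: if one of these is empty, so is \<open>\<P>\<close>,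
    and the others are arbitrary.\<close>
  have \<W>: "(\<Pi>\<^sub>E i\<in>{1..r}. Wi i) = \<Phi> ` \<P>"
  proof (intro equalityI subsetI)
    fix W assume W: "W \<in> (\<Pi>\<^sub>E i\<in>{1..r}. Wi i)"
    define P where "P = (\<lambda>s\<in>S. \<lambda>a\<in>A. W (h (s, a)))"
    have "P \<in> \<P>"
      unfolding \<P> P_def using PiE_mem[OF W h_mem] by (fastforce simp: Wi_def g_h)
    moreover have "W = \<Phi> P"
      using W g_in h_g by (auto simp: \<Phi>_def P_def fun_eq_iff PiE_iff extensional_def)
    ultimately show "W \<in> \<Phi> ` \<P>" by blast
  next
    fix W assume "W \<in> \<Phi> ` \<P>"
    then show "W \<in> (\<Pi>\<^sub>E i\<in>{1..r}. Wi i)"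
      using g_in by (auto simp: \<Phi>_def Wi_def \<P> PiE_iff)
  qed
  have \<P>_sub: "\<P> \<subseteq> transition_kernels S A" and "compact \<P>" "convex \<P>"
    using assms(2) unfolding uncertainty_set_def by auto
  have "compact (\<Phi> ` \<P>)"
    unfolding \<Phi>_def using \<open>compact \<P>\<close>
    by (intro compact_continuous_image continuous_on_restrict
        continuous_on_coordinate_pair)
  moreover have "convex (\<Phi> ` \<P>)"
    using \<open>convex \<P>\<close>
    by (rule convex_affine_image) (simp add: \<Phi>_def restrict_affine scaleR_fun_apply)
  moreover have "(\<Sum>s'\<in>S. \<Phi> P i s') = 1" if "P \<in> \<P>" "i \<in> {1..r}" for P i
    using that g_in \<P>_sub by (auto simp: \<Phi>_def transition_kernels_def)
  moreover have Wi_sub: "Wi i \<subseteq> S \<rightarrow>\<^sub>E {0..}" if "i \<in> {1..r}" for i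
    using sub g_in[OF that] by (simp add: Wi_def)
  then have "(\<Pi>\<^sub>E i\<in>{1..r}. Wi i) \<subseteq> {1..r} \<rightarrow>\<^sub>E S \<rightarrow>\<^sub>E {0..}" by (rule PiE_mono)
  ultimately have mat: "factor_matrices S r (\<Pi>\<^sub>E i\<in>{1..r}. Wi i)"
    unfolding factor_matrices_def \<W> by blast
  \<comment> \<open>Stated for arbitrary \<open>c\<close> to serve twice: constant 1 gives the
    coefficient sums, the entries of the factors give the kernel.\<close>
  have sum_u: "(\<Sum>i=1..r. u i s a * c i) = c (h (s, a))" if "s \<in> S" "a \<in> A" for s a c
  proof -
    have "(\<Sum>i=1..r. u i s a * c i) = (\<Sum>i=1..r. if i = h (s, a) then c i else 0)"
      unfolding u_def by (intro sum.cong) auto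
    then show ?thesis using h_mem[of "(s, a)"] that by simp
  qed
  have coeff: "factor_coefficients S A r u"
    using sum_u[where c = "\<lambda>_. 1"] by (auto simp: factor_coefficients_def u_def)
  have "factor_kernel S A r u (\<Phi> P) = P" if "P \<in> \<P>" for P
  proof -
    have P: "P \<in> S \<rightarrow>\<^sub>E A \<rightarrow>\<^sub>E S \<rightarrow>\<^sub>E {0..}"
      using subsetD[OF \<P>_sub that] by (simp add: transition_kernels_def)
    have "factor_kernel S A r u (\<Phi> P) = (\<lambda>s\<in>S. \<lambda>a\<in>A. \<lambda>s'\<in>S. \<Phi> P (h (s, a)) s')"
      unfolding factor_kernel_def by (intro restrict_ext sum_u)
    also have "\<dots> = (\<lambda>s\<in>S. \<lambda>a\<in>A. \<lambda>s'\<in>S. P s a s')"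
      using h_mem g_h by (intro restrict_ext) (fastforce simp: \<Phi>_def)
    \<comment> \<open>The restrictions are removed from the innermost outwards, as \<open>P\<close>
      is extensional at each level.\<close>
    also have "\<dots> = (\<lambda>s\<in>S. \<lambda>a\<in>A. P s a)"
      by (intro restrict_ext PiE_restrict[OF PiE_mem[OF PiE_mem[OF P]]])
    also have "\<dots> = (\<lambda>s\<in>S. P s)"
      by (intro restrict_ext PiE_restrict[OF PiE_mem[OF P]])
    also have "\<dots> = P"
      by (rule PiE_restrict[OF P])
    finally show ?thesis .
  qed
  then have "\<P> = factor_kernel S A r u ` (\<Pi>\<^sub>E i\<in>{1..r}. Wi i)"
    unfolding \<W> by (simp add: image_image)
  then show ?thesis
    unfolding r_rectangular_def factor_matrix_representation_def
    using r coeff mat Wi_sub by blast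
qed

section \<open>Counterexamples with two states\<close>

text \<open>For \<open>t\<close> in \<open>[0, 1]\<close> this runs through all distributions on two
  states, so a single real parameter describes every row used below.\<close>

definition two_state_dist :: "real \<Rightarrow> nat \<Rightarrow> real" where
  "two_state_dist t = (\<lambda>s\<in>{0, 1}. if s = 0 then t else 1 - t)"

lemma two_state_dist_apply [simp]:
  "two_state_dist t 0 = t" "two_state_dist t (Suc 0) = 1 - t"
  by (simp_all add: two_state_dist_def)

lemma two_state_dist_in_PiE: "t \<in> {0..1} \<Longrightarrow> two_state_dist t \<in> {0, 1} \<rightarrow>\<^sub>E {0..}"
  by (auto simp: two_state_dist_def)

lemma two_state_dist_affine:
  assumes "u + v = 1"
  shows "two_state_dist (u * t + v * t') = u *\<^sub>R two_state_dist t + v *\<^sub>R two_state_dist t'"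
  unfolding two_state_dist_def restrict_affine[OF assms] using assms
  by (intro restrict_ext) (auto simp: algebra_simps)

lemma continuous_on_two_state_dist:
  assumes "continuous_on X f"
  shows "continuous_on X (\<lambda>x. two_state_dist (f x))"
  unfolding two_state_dist_def using assms
  by (intro continuous_on_restrict) (auto intro!: continuous_intros)

lemma ex_r_rectangular_not_s_rectangular:
  "\<exists>(S :: nat set) (A :: nat set) \<P>.
     finite_spaces S A \<and> uncertainty_set S A \<P> \<and> r_rectangular S A \<P> \<and> \<not> s_rectangular S A \<P>"
proof -
  let ?S = "{0, 1} :: nat set" and ?A = "{0} :: nat set"
  let ?u = "\<lambda>(i :: nat) (s :: nat) (a :: nat). 1 :: real"
  define w where "w = (\<lambda>t. \<lambda>i\<in>{1..1::nat}. two_state_dist t)"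
  define \<W> where "\<W> = w ` {0..1}"
  define \<P> where "\<P> = factor_kernel ?S ?A 1 ?u ` \<W>"
  \<comment> \<open>The parametrised form yields compactness and convexity from the unit interval;
    the product form yields rectangularity.\<close>
  have \<W>: "\<W> = (\<Pi>\<^sub>E i\<in>{1..1}. two_state_dist ` {0..1})"
  proof (intro equalityI subsetI)
    fix W assume W: "W \<in> (\<Pi>\<^sub>E i\<in>{1..1::nat}. two_state_dist ` {0..1})"
    then obtain t where t: "t \<in> {0..1}" "W 1 = two_state_dist t" using PiE_mem[OF W, of 1] by auto
    have "W = w t" using W t by (auto simp: w_def fun_eq_iff PiE_iff extensional_def)
    then show "W \<in> \<W>" using t unfolding \<W>_def by blast
  qed (auto simp: \<W>_def w_def)
  have "compact \<W>"
    unfolding \<W>_def w_def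
    by (intro compact_continuous_image continuous_on_restrict continuous_on_two_state_dist
        continuous_on_id compact_Icc)
  moreover have "convex \<W>"
    unfolding \<W>_def
    by (intro convex_affine_image)
      (simp_all add: w_def restrict_affine two_state_dist_affine)
  moreover have "\<W> \<subseteq> {1..1} \<rightarrow>\<^sub>E ?S \<rightarrow>\<^sub>E {0..}"
    unfolding \<W> by (intro PiE_mono image_subsetI two_state_dist_in_PiE)
  ultimately have "factor_matrices ?S 1 \<W>"
    unfolding factor_matrices_def by (auto simp: \<W>_def w_def)
  then have rep: "factor_matrix_representation ?S ?A 1 ?u \<W> \<P>"
    by (simp add: factor_matrix_representation_def factor_coefficients_def \<P>_def)
  then have "r_rectangular ?S ?A \<P>"
    unfolding r_rectangular_def
    by (intro exI[of _ 1] exI[of _ ?u] exI[of _ \<W>] exI[of _ "\<lambda>_. two_state_dist ` {0..1}"]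
        conjI ballI \<W> image_subsetI two_state_dist_in_PiE)
  moreover have "\<not> s_rectangular ?S ?A \<P>"
  proof
    assume "s_rectangular ?S ?A \<P>"
    then obtain Ps where Ps: "\<P> = (\<Pi>\<^sub>E s\<in>?S. Ps s)" unfolding s_rectangular_def by blast
    define k where "k = (\<lambda>t. factor_kernel ?S ?A 1 ?u (w t))"
    have k: "k t \<in> \<P>" if "t \<in> {0..1}" for t
      using that by (auto simp: k_def \<P>_def \<W>_def)
    \<comment> \<open>Row 0 comes from \<open>k 0\<close> and row 1 from \<open>k 1\<close>. A
      product over states contains this mixture, but \<open>P = k t\<close> would force both
      \<open>t = 0\<close> and \<open>t = 1\<close>.\<close>
    define P where "P = (\<lambda>s\<in>?S. k (real s) s)"
    have "P \<in> \<P>"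
      using k[of 0] k[of 1] unfolding Ps P_def by (auto simp: PiE_iff)
    then obtain t where "P = k t" unfolding \<P>_def \<W>_def k_def by blast
    then have "P 0 0 0 = t" "P 1 0 0 = t" by (simp_all add: k_def factor_kernel_def w_def)
    then show False by (simp add: P_def k_def factor_kernel_def w_def)
  qed
  ultimately show ?thesis
    using uncertainty_set_factor_matrix[OF rep]
    by (intro exI[of _ ?S] exI[of _ ?A] exI[of _ \<P>]) (simp add: finite_spaces_def)
qed

lemma ex_s_rectangular_not_r_rectangular:
  "\<exists>(S :: nat set) (A :: nat set) \<P>.
     finite_spaces S A \<and> uncertainty_set S A \<P> \<and> s_rectangular S A \<P> \<and> \<not> r_rectangular S A \<P>"
proof -
  let ?S = "{0, 1} :: nat set" and ?A = "{0, 1} :: nat set"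
  \<comment> \<open>The two actions lead to state 0 with probabilities \<open>t\<close> and
    \<open>1 - t\<close>, which is the coupling. State 1 gets the fixed row block
    \<open>q 0\<close>, so the set is a segment times a point.\<close>
  define q where "q = (\<lambda>t. \<lambda>a\<in>?A. two_state_dist (if a = 0 then t else 1 - t))"
  define k where "k = (\<lambda>t. \<lambda>s\<in>?S. if s = 0 then q t else q 0)"
  define \<P> where "\<P> = k ` {0..1}"
  have q_mem: "q t \<in> ?A \<rightarrow>\<^sub>E ?S \<rightarrow>\<^sub>E {0..}" if "t \<in> {0..1}" for t
    using that two_state_dist_in_PiE[of t] two_state_dist_in_PiE[of "1 - t"]
    by (auto simp: q_def)
  have "k t \<in> transition_kernels ?S ?A" if "t \<in> {0..1}" for t
  proof -
    have "k t \<in> ?S \<rightarrow>\<^sub>E ?A \<rightarrow>\<^sub>E ?S \<rightarrow>\<^sub>E {0..}"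
      unfolding k_def restrict_PiE_iff using q_mem[OF that] q_mem[of 0] by simp
    then show ?thesis by (simp add: transition_kernels_def k_def q_def)
  qed
  then have "\<P> \<subseteq> transition_kernels ?S ?A"
    unfolding \<P>_def by blast
  moreover have q_cont: "continuous_on X q" for X
    unfolding q_def
    by (intro continuous_on_restrict continuous_on_two_state_dist) (auto intro!: continuous_intros)
  then have "compact \<P>"
    unfolding \<P>_def k_def
    by (intro compact_continuous_image continuous_on_restrict) auto
  moreover have "convex \<P>"
  proof -
    have q_affine: "q (u * t + v * t') = u *\<^sub>R q t + v *\<^sub>R q t'" if "u + v = 1" for u v t t'
    proof -
      \<comment> \<open>The reflection used for action 1 is affine, which again relies on
        \<open>u + v = 1\<close>.\<close>
      have "1 - (u * t + v * t') = u * (1 - t) + v * (1 - t')"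
        using that by (simp add: algebra_simps)
      then show ?thesis
        unfolding q_def restrict_affine[OF that]
        by (intro restrict_ext) (auto simp: two_state_dist_affine[OF that])
    qed
    show ?thesis
      unfolding \<P>_def
    proof (rule convex_affine_image)
      fix t t' u v :: real
      assume uv: "u + v = 1"
      show "k (u *\<^sub>R t + v *\<^sub>R t') = u *\<^sub>R k t + v *\<^sub>R k t'"
        unfolding k_def restrict_affine[OF uv]
        by (intro restrict_ext) (auto simp: q_affine[OF uv] uv simp flip: scaleR_left_distrib)
    qed simp
  qed
  moreover have "s_rectangular ?S ?A \<P>"
  proof -
    let ?Ps = "\<lambda>s :: nat. q ` (if s = 0 then {0..1} else {0})"
    have "\<P> = (\<Pi>\<^sub>E s\<in>?S. ?Ps s)"
    proof (intro equalityI subsetI)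
      fix P assume P: "P \<in> (\<Pi>\<^sub>E s\<in>?S. ?Ps s)"
      have "P 0 \<in> q ` {0..1}" using PiE_mem[OF P, of 0] by simp
      then obtain t where t: "t \<in> {0..1}" "P 0 = q t" by blast
      have "P 1 = q 0" using PiE_mem[OF P, of 1] by simp
      moreover have "P \<in> extensional ?S" using P by (simp add: PiE_iff)
      ultimately have "P = k t"
        using t by (intro extensionalityI[of P ?S]) (auto simp: k_def)
      then show "P \<in> \<P>" using t unfolding \<P>_def by blast
    next
      fix P assume "P \<in> \<P>"
      then obtain t where "t \<in> {0..1}" "P = k t" unfolding \<P>_def by blast
      then show "P \<in> (\<Pi>\<^sub>E s\<in>?S. ?Ps s)" unfolding k_def restrict_PiE_iff by auto
    qed
    moreover have "\<forall>s\<in>?S. ?Ps s \<subseteq> ?A \<rightarrow>\<^sub>E ?S \<rightarrow>\<^sub>E {0..}"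
      by (intro ballI image_subsetI q_mem) (simp split: if_splits)
    ultimately show ?thesis
      unfolding s_rectangular_def by (intro exI[of _ ?Ps] conjI)
  qed
  moreover have "\<not> r_rectangular ?S ?A \<P>"
  proof
    assume "r_rectangular ?S ?A \<P>"
    then obtain r u \<W> Wi where rep: "factor_matrix_representation ?S ?A r u \<W> \<P>"
      and \<W>: "\<W> = (\<Pi>\<^sub>E i\<in>{1..r}. Wi i)"
      unfolding r_rectangular_def by (elim exE conjE) (rule that)
    have \<P>: "\<P> = factor_kernel ?S ?A r u ` \<W>"
      and u: "\<And>a i. a \<in> ?A \<Longrightarrow> i \<in> {1..r} \<Longrightarrow> 0 \<le> u i 0 a"
      using rep unfolding factor_matrix_representation_def factor_coefficients_def by auto
    have "k 1 \<in> \<P>" "k 0 \<in> \<P>" by (auto simp: \<P>_def)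
    then obtain V W where V: "V \<in> \<W>" "k 1 = factor_kernel ?S ?A r u V"
      and W: "W \<in> \<W>" "k 0 = factor_kernel ?S ?A r u W"
      unfolding \<P> by blast
    define M where "M = (\<lambda>i\<in>{1..r}. if V i 0 \<le> W i 0 then W i else V i)"
    define K where "K = factor_kernel ?S ?A r u M"
    \<comment> \<open>Independence of the factors enters here: \<open>M\<close> mixes columns of
      \<open>V\<close> and \<open>W\<close>.\<close>
    have "M \<in> \<W>" using V(1) W(1) unfolding \<W> M_def by (auto simp: PiE_iff)
    then have "K \<in> \<P>" unfolding \<P> K_def by blast
    then obtain t where "K = k t" unfolding \<P>_def by blast
    then have "K 0 0 0 + K 0 1 0 = 1" by (simp add: k_def q_def)
    \<comment> \<open>The first argument of \<open>k\<close> is the parameter. Both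
      \<open>k 1 0 0 0\<close> and \<open>k 0 0 1 0\<close> equal 1, against the sum 1 just obtained
      for \<open>K\<close>.\<close>
    moreover have "k 1 0 0 0 \<le> K 0 0 0"
      unfolding V(2) K_def factor_kernel_def
      using u by (auto intro!: sum_mono mult_left_mono simp: M_def)
    moreover have "k 0 0 1 0 \<le> K 0 1 0"
      unfolding W(2) K_def factor_kernel_def
      using u by (auto intro!: sum_mono mult_left_mono simp: M_def)
    ultimately show False by (simp add: k_def q_def)
  qed
  ultimately show ?thesis
    by (intro exI[of _ ?S] exI[of _ ?A] exI[of _ \<P>])
      (simp add: finite_spaces_def uncertainty_set_def)
qed

theorem proposition2p3:
  shows "(\<forall>(S :: 's set) (A :: 'a set) \<P>.
            finite_spaces S A \<and> uncertainty_set S A \<P> \<and> sa_rectangular S A \<P> \<longrightarrow>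
              r_rectangular S A \<P>) \<and>
         (\<exists>(S :: nat set) (A :: nat set) \<P>.
            finite_spaces S A \<and> uncertainty_set S A \<P> \<and>
              r_rectangular S A \<P> \<and> \<not> s_rectangular S A \<P>) \<and>
         (\<exists>(S :: nat set) (A :: nat set) \<P>.
            finite_spaces S A \<and> uncertainty_set S A \<P> \<and>
              r_rectangular S A \<P> \<and> \<not> sa_rectangular S A \<P>) \<and>
         (\<exists>(S :: nat set) (A :: nat set) \<P>.
            finite_spaces S A \<and> uncertainty_set S A \<P> \<and>
              s_rectangular S A \<P> \<and> \<not> r_rectangular S A \<P>)"
proof (intro conjI allI impI)
  fix S :: "'s set" and A :: "'a set" and \<P>
  assume "finite_spaces S A \<and> uncertainty_set S A \<P> \<and> sa_rectangular S A \<P>"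
  then show "r_rectangular S A \<P>"
    by (simp add: sa_rectangular_imp_r_rectangular)
next
  show "\<exists>(S :: nat set) (A :: nat set) \<P>. finite_spaces S A \<and> uncertainty_set S A \<P> \<and>
          r_rectangular S A \<P> \<and> \<not> sa_rectangular S A \<P>"
    using ex_r_rectangular_not_s_rectangular sa_rectangular_imp_s_rectangular by meson
qed (rule ex_r_rectangular_not_s_rectangular ex_s_rectangular_not_r_rectangular)+

end
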